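(* Let $q$ be a prime power, let $\mathcal{S}=(s_i)_{i=0}^\infty$ be a sequence over the finite field $\mathbb{F}_q$ with generating function $G(x)=\sum_{i=0}^\infty s_ix^i$, and let $N\ge 2$ be an integer such that $$G(x)\not\equiv 0\bmod x^N.$$ Let $L_N=L_N(\mathcal{S})$ be the $N$th linear complexity of $\mathcal{S}$ and let $$\sum_{\ell=t_N}^{L_N}c_\ell s_{i+\ell}=0,\qquad 0\le i\le N-L_N-1,$$ be a shortest linear recurrence for the first $N$ terms of $\mathcal{S}$, where $0\le t_N\le L_N$, $c_\ell\in\mathbb{F}_q$, $c_{L_N}=1$ and $c_{t_N}\ne 0$. Then $$E_N(\mathcal{S})\ge\begin{cases} L_N-t_N+1 & \text{if } N>(L_N-t_N)\,(L_N-\min\{1,t_N-1\}),\\ \left\lceil\dfrac{N}{L_N-\min\{1,t_N-1\}}\right\rceil & \text{otherwise,}\end{cases}$$ and $$E_N(\mathcal{S})\le\min\{L_N(\mathcal{S})+\max\{-1,-t_N+1\},\ N-L_N(\mathcal{S})+2\}.$$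
   Context: $\mathbb{F}_q$ is the finite field with $q$ elements. For a sequence $\mathcal{S}=(s_i)_{i=0}^\infty$ over $\mathbb{F}_q$ and a positive integer $N$, the $N$th linear complexity $L_N(\mathcal{S})$ is the least nonnegative integer $L_N$ for which there are $c_0,\ldots,c_{L_N-1}\in\mathbb{F}_q$ with $s_{i+L_N}+\sum_{\ell=0}^{L_N-1}c_\ell s_{i+\ell}=0$ for $0\le i\le N-L_N-1$ (with $L_N=0$ if $s_0=\cdots=s_{N-1}=0$, and $L_N=N$ if $s_0=\cdots=s_{N-2}=0\neq s_{N-1}$). A shortest linear recurrence for the first $N$ terms is one of this form with length exactly $L_N(\mathcal{S})$; setting $c_{L_N}=1$, $t_N$ is the smallest index with $c_{t_N}\ne0$. The $N$th expansion complexity $E_N(\mathcal{S})$ is defined by $E_N(\mathcal{S})=0$ if $s_0=\cdots=s_{N-1}=0$, and otherwise $E_N(\mathcal{S})$ is the least total degree of a nonzero polynomial $h(x,y)\in\mathbb{F}_q[x,y]$ with $h(x,G(x))\equiv 0\bmod x^N$, where $G(x)=\sum_{i=0}^\infty s_ix^i\in\mathbb{F}_q[[x]]$. *)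

theory Defs
  imports "HOL-Computational_Algebra.Computational_Algebra"
begin

text \<open>The boundary values of the linear complexity (\<open>0\<close> for an all-zero prefix, \<open>N\<close> for a prefix
  whose only nonzero term is the last one) need no separate clauses; see the two lemmas below.\<close>

definition linear_complexity :: "(nat \<Rightarrow> 'a::field) \<Rightarrow> nat \<Rightarrow> nat" where
  "linear_complexity s N =
     (LEAST L. \<exists>c :: nat \<Rightarrow> 'a. \<forall>i. i + L < N \<longrightarrow> s (i + L) + (\<Sum>l<L. c l * s (i + l)) = 0)"

lemma linear_complexity_zero:
  assumes "\<forall>i<N. s i = 0"
  shows "linear_complexity s N = 0"
  unfolding linear_complexity_def by (rule Least_equality) (use assms in auto)

lemma linear_complexity_last:
  assumes "N > 0" "\<forall>i<N - 1. s i = 0" "s (N - 1) \<noteq> 0"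
  shows "linear_complexity s N = N"
  unfolding linear_complexity_def
proof (rule Least_equality)
  fix L assume "\<exists>c. \<forall>i. i + L < N \<longrightarrow> s (i + L) + (\<Sum>l<L. c l * s (i + l)) = 0"
  then obtain c where c: "\<And>i. i + L < N \<Longrightarrow> s (i + L) + (\<Sum>l<L. c l * s (i + l)) = 0"
    by blast
  show "N \<le> L"
  proof (rule ccontr)
    assume "\<not> N \<le> L"
    moreover from this have "(\<Sum>l<L. c l * s (N - 1 - L + l)) = 0"
      using assms(2) by (intro sum.neutral) auto
    ultimately show False using c[of "N - 1 - L"] assms(1,3) by auto
  qed
qed auto

text \<open>A bivariate polynomial \<open>h(x,y)\<close> is an element of \<open>'a poly poly\<close>: the outer variable is \<open>y\<close>
  and the inner one is \<open>x\<close>, so \<open>coeff (coeff h j) i\<close> is the coefficient of \<open>x\<^sup>i y\<^sup>j\<close>.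
  The element \<open>0\<close> is inserted only to give the zero polynomial a value.\<close>

definition total_degree :: "'a::zero poly poly \<Rightarrow> nat" where
  "total_degree h = Max (insert 0 {i + j | i j. coeff (coeff h j) i \<noteq> 0})"

lemma finite_total_degree_set:
  "finite {i + j | i j. coeff (coeff (h :: 'a::zero poly poly) j) i \<noteq> 0}"
proof (rule finite_subset)
  show "{i + j | i j. coeff (coeff h j) i \<noteq> 0} \<subseteq>
      (\<lambda>(j, i). i + j) ` (SIGMA j:{..degree h}. {..degree (coeff h j)})"
  proof
    fix d assume "d \<in> {i + j | i j. coeff (coeff h j) i \<noteq> 0}"
    then obtain i j where ij: "d = i + j" "coeff (coeff h j) i \<noteq> 0" by blast
    then have "coeff h j \<noteq> 0" by auto
    then have "j \<le> degree h" "i \<le> degree (coeff h j)" using ij(2) by (auto intro: le_degree)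
    then show "d \<in> (\<lambda>(j, i). i + j) ` (SIGMA j:{..degree h}. {..degree (coeff h j)})"
      using ij(1) by force
  qed
qed auto

definition eval_y :: "'a::field poly poly \<Rightarrow> 'a fps \<Rightarrow> 'a fps" where
  "eval_y h G = poly (map_poly fps_of_poly h) G"

definition expansion_complexity :: "(nat \<Rightarrow> 'a::field) \<Rightarrow> nat \<Rightarrow> nat" where
  "expansion_complexity s N =
     (if \<forall>i<N. s i = 0 then 0
      else LEAST d. \<exists>h :: 'a poly poly.
             h \<noteq> 0 \<and> total_degree h = d \<and> fps_X ^ N dvd eval_y h (Abs_fps s))"

end

theory Submission imports Defs begin

text \<open>
  The recurrence is a rational approximation of the generating function \<open>G\<close>. Its reciprocal
  polynomial \<open>f = (\<Sum>l=t..L. c\<^sub>l x\<^bsup>L-l\<^esup>)\<close> has \<open>f(0) = 1\<close> and degree exactly \<open>L - t\<close>, and the recurrence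
  says that \<open>f G \<equiv> g\<close> modulo \<open>x\<^sup>N\<close> for a polynomial \<open>g\<close> of degree less than \<open>L\<close>. Conversely, every
  such approximation with bounds \<open>K\<close> on \<open>degree f\<close> and \<open>K - 1\<close> on \<open>degree g\<close> yields a recurrence of
  length \<open>K\<close> (\<open>linear_complexity_le\<close>), so \<open>L\<close> is the smallest possible \<open>K\<close>.

  Both upper bounds come from polynomials \<open>a y - b\<close> (\<open>expansion_complexity_le_linear\<close>). The pair
  \<open>(f, g)\<close> has total degree at most \<open>max (L - t + 1) (L - 1)\<close>, which is the first bound. For the
  second, no recurrence of length \<open>L - 1\<close> exists; this is an unsolvable Hankel system, and a linear
  combination of its rows witnessing this is the coefficient vector of a polynomial \<open>a\<close> of degree
  at most \<open>N - L\<close> for which \<open>a G\<close> modulo \<open>x\<^sup>N\<close> has no terms of degree \<open>N - L\<close> or more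
  except one of degree \<open>N - 1\<close>. Multiplication by \<open>x\<close> pushes that last term beyond the precision.

  For the lower bound, let \<open>h\<close> have total degree \<open>E\<close>, degree \<open>m\<close> in \<open>y\<close>, and
  \<open>h(x, G) \<equiv> 0\<close> modulo \<open>x\<^sup>N\<close>. Then
  the polynomial \<open>R = f\<^sup>m h(x, g/f)\<close> is divisible by \<open>x\<^sup>N\<close>. If \<open>R \<noteq> 0\<close>, its degree is at least
  \<open>N\<close> and at most \<open>E (L - min 1 (t - 1))\<close>. If \<open>R = 0\<close>, then \<open>g/f\<close> is a root of \<open>h\<close> in \<open>y\<close>; it is
  in lowest terms by the minimality of \<open>L\<close>, so, as in the rational root theorem, \<open>f\<close> divides the
  leading coefficient of \<open>h\<close>, and therefore \<open>E > degree f = L - t\<close>.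
\<close>

section \<open>Truncated power series\<close>

lemma fps_X_power_dvd_iff:
  fixes F :: "'a::comm_ring_1 fps"
  shows "fps_X ^ n dvd F \<longleftrightarrow> (\<forall>k<n. fps_nth F k = 0)"
proof
  assume "fps_X ^ n dvd F"
  then obtain H where "F = fps_X ^ n * H" by (elim dvdE)
  then show "\<forall>k<n. fps_nth F k = 0" by (simp add: fps_X_power_mult_nth)
next
  assume "\<forall>k<n. fps_nth F k = 0"
  then have "fps_cutoff n F = 0" by (simp add: fps_eq_iff)
  then show "fps_X ^ n dvd F"
    by (metis fps_cutoff_zero_iff fps_shift_times_fps_X_power dvd_0_right dvd_triv_right)
qed

lemma coeff_truncate_fps: "coeff (truncate_fps n F) k = (if k < n then fps_nth F k else 0)"
  by (metis fps_cutoff_nth fps_of_poly_nth fps_of_poly_truncate)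

text \<open>
  Coefficients of a product with a reciprocal polynomial are recurrence expressions: this is the
  dictionary between multiplying the generating function and applying a recurrence to the
  sequence.
\<close>
lemma fps_mult_nth_reversed:
  fixes p :: "'a::comm_semiring_1 poly"
  assumes "degree p \<le> n"
  shows "fps_nth (fps_of_poly p * G) (i + n) = (\<Sum>l\<le>n. coeff p (n - l) * fps_nth G (i + l))"
proof -
  have "fps_nth (fps_of_poly p * G) (i + n) = (\<Sum>k=0..i+n. coeff p k * fps_nth G (i + n - k))"
    by (simp add: fps_mult_nth)
  also have "\<dots> = (\<Sum>k\<le>n. coeff p k * fps_nth G (i + n - k))"
    using assms by (intro sum.mono_neutral_right) (auto simp: coeff_eq_0)
  also have "\<dots> = (\<Sum>l\<le>n. coeff p (n - l) * fps_nth G (i + l))"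
    by (rule sum.reindex_bij_witness[of _ "\<lambda>l. n - l" "\<lambda>l. n - l"]) auto
  finally show ?thesis .
qed

section \<open>Linear complexity and short recurrences\<close>

text \<open>
  A rational approximation of \<open>G\<close> whose denominator does not vanish at \<open>0\<close> becomes a recurrence
  once the denominator is scaled to constant term \<open>1\<close>, which is the leading coefficient of the
  recurrence.
\<close>
lemma linear_complexity_le:
  fixes s :: "nat \<Rightarrow> 'a::field"
  assumes "coeff f 0 \<noteq> 0" "degree f \<le> K"
    and "\<And>k. K \<le> k \<Longrightarrow> k < N \<Longrightarrow> fps_nth (fps_of_poly f * Abs_fps s) k = 0"
  shows "linear_complexity s N \<le> K"
  unfolding linear_complexity_def
proof (rule Least_le, intro exI allI impI)
  fix i assume i: "i + K < N"
  have "0 = (\<Sum>l\<le>K. coeff f (K - l) * s (i + l))"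
    using assms(3)[of "i + K"] i fps_mult_nth_reversed[OF assms(2)] by simp
  also have "{..K} = insert K {..<K}" by auto
  finally have "coeff f 0 * s (i + K) + (\<Sum>l<K. coeff f (K - l) * s (i + l)) = 0" by simp
  then have "s (i + K) = - (\<Sum>l<K. coeff f (K - l) * s (i + l)) / coeff f 0"
    using assms(1) by (simp add: field_simps eq_neg_iff_add_eq_0)
  then show "s (i + K) + (\<Sum>l<K. (coeff f (K - l) / coeff f 0) * s (i + l)) = 0"
    by (simp add: sum_divide_distrib)
qed

text \<open>
  The Fredholm alternative, by induction on the number of columns. Apply the induction hypothesis
  to the new column in place of the right-hand side. Either the new column depends on the earlier
  ones and is redundant, or some functional \<open>u\<close> kills the earlier columns and takes the value \<open>1\<close>
  on it; in that case \<open>u\<close> serves to project the right-hand side, or a separating functional,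
  along the new column.
\<close>
lemma linear_system_alternative:
  fixes A :: "nat \<Rightarrow> nat \<Rightarrow> 'a::field" and b :: "nat \<Rightarrow> 'a"
  shows "(\<exists>c. \<forall>i<m. (\<Sum>l<n. c l * A i l) = b i) \<or>
         (\<exists>u. (\<forall>l<n. (\<Sum>i<m. u i * A i l) = 0) \<and> (\<Sum>i<m. u i * b i) = 1)"
proof (induction n arbitrary: b)
  case 0
  show ?case
  proof (cases "\<forall>i<m. b i = 0")
    case False
    then obtain j where j: "j < m" "b j \<noteq> 0" by blast
    have "(\<Sum>i<m. (if i = j then 1 / b j else 0) * b i)
        = (\<Sum>i<m. if i = j then 1 / b j * b i else 0)"
      by (intro sum.cong) auto
    also have "\<dots> = 1" using j by simp
    finally have "(\<Sum>i<m. (if i = j then 1 / b j else 0) * b i) = 1" .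
    then show ?thesis by (intro disjI2 exI[of _ "\<lambda>i. if i = j then 1 / b j else 0"]) simp
  qed auto
next
  case (Suc n)
  consider (span) c where "\<And>i. i < m \<Longrightarrow> (\<Sum>l<n. c l * A i l) = A i n"
    | (indep) u where "\<And>l. l < n \<Longrightarrow> (\<Sum>i<m. u i * A i l) = 0" "(\<Sum>i<m. u i * A i n) = 1"
    using Suc.IH[of "\<lambda>i. A i n"] by blast
  then show ?case
  proof cases
    case span
    consider (sol) d where "\<And>i. i < m \<Longrightarrow> (\<Sum>l<n. d l * A i l) = b i"
      | (sep) u where "\<And>l. l < n \<Longrightarrow> (\<Sum>i<m. u i * A i l) = 0" "(\<Sum>i<m. u i * b i) = 1"
      using Suc.IH[of b] by blast
    then show ?thesis
    proof cases
      case sol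
      then show ?thesis
        by (intro disjI1 exI[of _ "d(n := 0)"]) simp
    next
      case sep
      have "(\<Sum>i<m. u i * A i n) = (\<Sum>i<m. u i * (\<Sum>l<n. c l * A i l))"
        by (intro sum.cong) (auto simp: span)
      also have "\<dots> = (\<Sum>l<n. c l * (\<Sum>i<m. u i * A i l))"
        by (subst (1 2) sum_distrib_left, subst sum.swap) (simp add: mult_ac sum_distrib_left)
      also have "\<dots> = 0" by (simp add: sep)
      finally have "(\<Sum>i<m. u i * A i n) = 0" .
      with sep show ?thesis by (intro disjI2 exI[of _ u]) (auto simp: less_Suc_eq)
    qed
  next
    case indep
    define \<beta> where "\<beta> = (\<Sum>i<m. u i * b i)"
    consider (sol) d where "\<And>i. i < m \<Longrightarrow> (\<Sum>l<n. d l * A i l) = b i - \<beta> * A i n"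
      | (sep) v where "\<And>l. l < n \<Longrightarrow> (\<Sum>i<m. v i * A i l) = 0"
          "(\<Sum>i<m. v i * (b i - \<beta> * A i n)) = 1"
      using Suc.IH[of "\<lambda>i. b i - \<beta> * A i n"] by blast
    then show ?thesis
    proof cases
      case sol
      then show ?thesis
        by (intro disjI1 exI[of _ "d(n := \<beta>)"]) simp
    next
      case sep
      define \<alpha> where "\<alpha> = (\<Sum>i<m. v i * A i n)"
      define w where "w = (\<lambda>i. v i - \<alpha> * u i)"
      have w: "(\<Sum>i<m. w i * z i) = (\<Sum>i<m. v i * z i) - \<alpha> * (\<Sum>i<m. u i * z i)" for z
        by (simp add: w_def left_diff_distrib sum_subtractf sum_distrib_left mult.assoc)
      have "(\<Sum>i<m. v i * (b i - \<beta> * A i n)) = (\<Sum>i<m. v i * b i) - \<beta> * \<alpha>"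
        by (simp add: \<alpha>_def right_diff_distrib sum_subtractf sum_distrib_left mult_ac)
      then have "(\<Sum>i<m. w i * b i) = 1"
        using sep(2) by (simp only: w \<beta>_def[symmetric] mult.commute[of \<alpha>])
      moreover have "(\<Sum>i<m. w i * A i l) = 0" if "l < Suc n" for l
        using that sep(1) indep by (auto simp: w \<alpha>_def less_Suc_eq)
      ultimately show ?thesis by blast
    qed
  qed
qed

text \<open>
  The recurrences of length \<open>K\<close> are the solutions of a Hankel system with \<open>N - K\<close> equations. A
  functional showing that it has none is a combination of rows; Hankel rows are shifts of the
  sequence, so this combination is again a recurrence for the sequence, of order less than
  \<open>N - K\<close>, that is valid up to but not including the last term.
\<close>
lemma annihilator_if_linear_complexity_gt:
  fixes s :: "nat \<Rightarrow> 'a::field"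
  assumes "K < linear_complexity s N" "K < N"
  obtains a where "a \<noteq> 0" "degree a < N - K"
    and "\<And>k. N - K \<le> Suc k \<Longrightarrow> Suc k < N \<Longrightarrow> fps_nth (fps_of_poly a * Abs_fps s) k = 0"
proof -
  define m where "m = N - K"
  have m: "m > 0" using assms(2) by (simp add: m_def)
  have no: "\<nexists>c. \<forall>i<m. (\<Sum>l<K. c l * s (i + l)) = - s (i + K)"
  proof
    assume "\<exists>c. \<forall>i<m. (\<Sum>l<K. c l * s (i + l)) = - s (i + K)"
    then obtain c where c: "\<forall>i<m. (\<Sum>l<K. c l * s (i + l)) = - s (i + K)" ..
    have "\<exists>c. \<forall>i. i + K < N \<longrightarrow> s (i + K) + (\<Sum>l<K. c l * s (i + l)) = 0"
      using c by (intro exI[of _ c]) (simp add: m_def less_diff_conv)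
    then have "linear_complexity s N \<le> K"
      unfolding linear_complexity_def by (rule Least_le)
    then show False using assms(1) by simp
  qed
  obtain u where u: "\<And>l. l < K \<Longrightarrow> (\<Sum>i<m. u i * s (i + l)) = 0"
    and u1: "(\<Sum>i<m. u i * - s (i + K)) = 1"
    using linear_system_alternative[where m = m and n = K and A = "\<lambda>i l. s (i + l)"
        and b = "\<lambda>i. - s (i + K)"] no by blast
  define a where "a = truncate_fps m (Abs_fps (\<lambda>k. u (m - 1 - k)))"
  have coeff_a: "coeff a k = (if k < m then u (m - 1 - k) else 0)" for k
    by (simp add: a_def coeff_truncate_fps)
  have deg: "degree a \<le> m - 1" by (rule degree_le) (auto simp: coeff_a)
  have "a \<noteq> 0"
  proof
    assume "a = 0"
    have "u i = 0" if "i < m" for i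
      using coeff_a[of "m - 1 - i"] that \<open>a = 0\<close> by auto
    then show False using u1 by simp
  qed
  moreover have "degree a < N - K" using deg m by (simp add: m_def)
  moreover have "fps_nth (fps_of_poly a * Abs_fps s) k = 0" if k: "N - K \<le> Suc k" "Suc k < N" for k
  proof -
    define l where "l = k - (m - 1)"
    have l: "l < K" "k = l + (m - 1)" using k m by (auto simp: l_def m_def)
    have "fps_nth (fps_of_poly a * Abs_fps s) k = (\<Sum>i\<le>m - 1. u i * s (l + i))"
      unfolding l(2) fps_mult_nth_reversed[OF deg] using m
      by (intro sum.cong) (auto simp: coeff_a)
    also have "{..m - 1} = {..<m}" using m by auto
    finally show ?thesis using u[OF l(1)] by (simp add: add.commute)
  qed
  ultimately show ?thesis using that by blast
qed

section \<open>Total degree and expansion complexity\<close>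

lemma total_degree_ge:
  "coeff (coeff h j) i \<noteq> 0 \<Longrightarrow> i + j \<le> total_degree h"
  unfolding total_degree_def by (intro Max_ge) (auto intro: finite_total_degree_set)

lemma total_degree_le:
  assumes "\<And>i j. coeff (coeff h j) i \<noteq> 0 \<Longrightarrow> i + j \<le> d"
  shows "total_degree h \<le> d"
  unfolding total_degree_def
  by (intro Max.boundedI) (auto intro: finite_total_degree_set assms)

lemma degree_coeff_add_le_total_degree:
  assumes "coeff h j \<noteq> 0"
  shows "degree (coeff h j) + j \<le> total_degree h"
  using assms by (intro total_degree_ge) simp

lemma expansion_complexity_le:
  assumes "h \<noteq> 0" "fps_X ^ N dvd eval_y h (Abs_fps s)"
  shows "expansion_complexity s N \<le> total_degree h"
  unfolding expansion_complexity_def using assms by (auto intro: Least_le)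

lemma expansion_complexity_attained:
  assumes "\<exists>i<N. s i \<noteq> 0"
  obtains h where "h \<noteq> 0" "fps_X ^ N dvd eval_y h (Abs_fps s)"
    and "total_degree h = expansion_complexity s N"
proof -
  let ?P = "\<lambda>d. \<exists>h. h \<noteq> 0 \<and> total_degree h = d \<and> fps_X ^ N dvd eval_y h (Abs_fps s)"
  have "eval_y [:monom 1 N:] (Abs_fps s) = fps_X ^ N"
    by (simp add: eval_y_def map_poly_pCons fps_of_poly_monom')
  then have "?P (total_degree [:monom 1 N :: 'a poly:])"
    by (intro exI[of _ "[:monom 1 N:]"]) simp
  then have "?P (Least ?P)" by (rule LeastI)
  moreover have "expansion_complexity s N = Least ?P"
    unfolding expansion_complexity_def using assms by auto
  ultimately show ?thesis using that by auto
qed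

text \<open>
  The polynomial is \<open>a y - b\<close>, where \<open>b\<close> is the part of \<open>a G\<close> of degree at most \<open>D\<close>.
\<close>
lemma expansion_complexity_le_linear:
  fixes s :: "nat \<Rightarrow> 'a::field"
  assumes "a \<noteq> 0" "degree a < D"
    and "\<And>k. D < k \<Longrightarrow> k < N \<Longrightarrow> fps_nth (fps_of_poly a * Abs_fps s) k = 0"
  shows "expansion_complexity s N \<le> D"
proof -
  define b where "b = truncate_fps (Suc D) (fps_of_poly a * Abs_fps s)"
  define h where "h = [:- b, a:]"
  have "eval_y h (Abs_fps s) = fps_of_poly a * Abs_fps s - fps_of_poly b"
    using assms(1)
    by (simp add: eval_y_def h_def map_poly_pCons fps_of_poly_uminus mult.commute)
  then have "fps_X ^ N dvd eval_y h (Abs_fps s)"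
    using assms(3) by (auto simp: fps_X_power_dvd_iff b_def coeff_truncate_fps)
  moreover have "h \<noteq> 0" using assms(1) by (simp add: h_def)
  moreover have "total_degree h \<le> D"
  proof (rule total_degree_le)
    fix i j assume *: "coeff (coeff h j) i \<noteq> 0"
    then consider "j = 0" "coeff b i \<noteq> 0" | "j = 1" "coeff a i \<noteq> 0"
      by (auto simp: h_def coeff_pCons split: nat.splits)
    then show "i + j \<le> D"
    proof cases
      case 1
      then show ?thesis by (simp add: b_def coeff_truncate_fps split: if_splits)
    next
      case 2
      then show ?thesis using le_degree[of a i] assms(2) by simp
    qed
  qed
  ultimately show ?thesis using expansion_complexity_le order_trans by blast
qed

section \<open>Coprimality of a shortest rational approximation\<close>

text \<open>
  An element of least degree in the ideal generated by \<open>f\<close> and \<open>g\<close> divides every element of the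
  ideal, because the remainder would be a smaller one.
\<close>
lemma poly_bezout:
  fixes f g :: "'a::field poly"
  assumes "f \<noteq> 0"
  obtains d u v where "d \<noteq> 0" "d dvd f" "d dvd g" "d = u * f + v * g"
proof -
  define I where "I = {d. d \<noteq> 0 \<and> (\<exists>u v. d = u * f + v * g)}"
  have "f = 1 * f + 0 * g" by simp
  then have "f \<in> I" using assms unfolding I_def by blast
  then obtain d where d: "d \<in> I" and min: "\<And>e. e \<in> I \<Longrightarrow> degree d \<le> degree e"
    using ex_has_least_nat[of "\<lambda>d. d \<in> I" f degree] by blast
  obtain u v where uv: "d = u * f + v * g" and d0: "d \<noteq> 0" using d by (auto simp: I_def)
  have dvd: "d dvd u' * f + v' * g" for u' v'
  proof (rule ccontr)
    let ?p = "u' * f + v' * g"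
    assume "\<not> d dvd ?p"
    then have r: "?p mod d \<noteq> 0" by (simp add: dvd_eq_mod_eq_0)
    have "?p mod d = (u' - ?p div d * u) * f + (v' - ?p div d * v) * g"
      unfolding minus_div_mult_eq_mod[symmetric] by (subst (2) uv) (simp add: algebra_simps)
    with r have "?p mod d \<in> I" unfolding I_def by blast
    then have "degree d \<le> degree (?p mod d)" by (rule min)
    moreover have "degree (?p mod d) < degree d"
      using degree_mod_less[OF d0, of ?p] r by simp
    ultimately show False by simp
  qed
  have "d dvd f" using dvd[of 1 0] by simp
  moreover have "d dvd g" using dvd[of 0 1] by simp
  ultimately show ?thesis using that d0 uv by blast
qed

text \<open>
  A common divisor of \<open>f\<close> and \<open>g\<close> has nonzero constant term, hence is a unit among power series
  and can be cancelled from the congruence. If it had positive degree, the cancelled pair would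
  give a recurrence shorter than the linear complexity.
\<close>
lemma minimal_pair_bezout:
  fixes s :: "nat \<Rightarrow> 'a::field" and N :: nat
  defines "L \<equiv> linear_complexity s N"
  assumes "L > 0" "coeff f 0 \<noteq> 0" "degree f \<le> L" "degree g < L"
    and cong: "fps_X ^ N dvd fps_of_poly f * Abs_fps s - fps_of_poly g"
  obtains u v where "u * f + v * g = 1"
proof -
  have f0: "f \<noteq> 0" using assms(3) by auto
  obtain d u v where d0: "d \<noteq> 0" and df: "d dvd f" and dg: "d dvd g" and uv: "d = u * f + v * g"
    using poly_bezout[OF f0] by metis
  obtain f1 where f1: "f = d * f1" using df by (elim dvdE)
  obtain g1 where g1: "g = d * g1" using dg by (elim dvdE)
  have f10: "coeff f1 0 \<noteq> 0" and dc: "coeff d 0 \<noteq> 0"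
    using assms(3) by (auto simp: f1 coeff_mult_0)
  have "degree d = 0"
  proof (rule ccontr)
    assume pos: "degree d \<noteq> 0"
    have "fps_X ^ N dvd fps_of_poly d * (fps_of_poly f1 * Abs_fps s - fps_of_poly g1)"
      using cong by (simp add: f1 g1 fps_of_poly_mult algebra_simps)
    moreover have "is_unit (fps_of_poly d)" using dc by simp
    ultimately have "fps_X ^ N dvd fps_of_poly f1 * Abs_fps s - fps_of_poly g1"
      using dvd_mult_unit_iff' by blast
    then have nth: "fps_nth (fps_of_poly f1 * Abs_fps s) k = coeff g1 k" if "k < N" for k
      using that by (simp add: fps_X_power_dvd_iff)
    have "degree f1 \<le> L - 1"
      using assms(2,4) pos f0 by (auto simp: f1 degree_mult_eq)
    moreover have "coeff g1 k = 0" if "L - 1 \<le> k" for k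
    proof (cases "g1 = 0")
      case False
      then have "degree g1 < k"
        using assms(2,5) pos d0 that by (simp add: g1 degree_mult_eq)
      then show ?thesis by (rule coeff_eq_0)
    qed simp
    ultimately have "L \<le> L - 1"
      unfolding L_def using f10 nth by (intro linear_complexity_le) (auto simp: L_def)
    then show False using assms(2) by simp
  qed
  then obtain e where e: "d = [:e:]" "e \<noteq> 0" using d0 by (metis degree_eq_zeroE pCons_0_0)
  have "smult (1 / e) u * f + smult (1 / e) v * g = smult (1 / e) d"
    by (simp add: uv smult_add_right)
  also have "\<dots> = 1" using e by (simp add: one_pCons)
  finally show ?thesis using that by blast
qed

lemma dvd_mult_power_cancel_bezout:
  fixes f g :: "'a::comm_ring_1"
  assumes "u * f + v * g = 1" "f dvd p * g ^ m"
  shows "f dvd p"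
  using assms(2)
proof (induction m)
  case (Suc m)
  have "p * g ^ m = (p * g ^ m) * (u * f + v * g)" by (simp add: assms(1))
  also have "\<dots> = f * (u * p * g ^ m) + v * (p * g ^ Suc m)" by (simp add: algebra_simps)
  also have "f dvd \<dots>" using Suc.prems by (intro dvd_add) auto
  finally show ?case by (rule Suc.IH)
qed simp

section \<open>Eliminating y\<close>

text \<open>
  This is \<open>f\<^sup>m h(x, g/f)\<close> with \<open>m\<close> the degree of \<open>h\<close> in \<open>y\<close>. Up to sign it is the resultant of
  \<open>h\<close> and \<open>f y - g\<close> with respect to \<open>y\<close>.
\<close>
definition eliminate_y :: "'a::field poly poly \<Rightarrow> 'a poly \<Rightarrow> 'a poly \<Rightarrow> 'a poly" where
  "eliminate_y h f g = (\<Sum>j\<le>degree h. coeff h j * g ^ j * f ^ (degree h - j))"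

text \<open>
  Clearing denominators turns \<open>f\<^sup>m h(x, G)\<close> into a polynomial expression in \<open>f\<close> and \<open>f G\<close>, and
  \<open>f G\<close> may be replaced by \<open>g\<close> modulo \<open>x\<^sup>N\<close>.
\<close>
lemma fps_X_power_dvd_eliminate_y:
  assumes cong: "fps_X ^ N dvd fps_of_poly f * G - fps_of_poly g"
    and h: "fps_X ^ N dvd eval_y h G"
  shows "fps_X ^ N dvd fps_of_poly (eliminate_y h f g)"
proof -
  let ?F = "fps_of_poly f" and ?g = "fps_of_poly g" and ?m = "degree h"
  let ?c = "\<lambda>j. fps_of_poly (coeff h j)"
  have deg: "degree (map_poly fps_of_poly h) = ?m"
    by (intro degree_map_poly) (metis fps_of_poly_0 fps_of_poly_eq_iff)
  have "?F ^ ?m * eval_y h G = (\<Sum>j\<le>?m. ?c j * (?F * G) ^ j * ?F ^ (?m - j))"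
    unfolding eval_y_def poly_altdef deg sum_distrib_left
  proof (intro sum.cong refl)
    fix j assume "j \<in> {..?m}"
    then have "?F ^ ?m = ?F ^ j * ?F ^ (?m - j)" by (simp flip: power_add)
    then show "?F ^ ?m * (coeff (map_poly fps_of_poly h) j * G ^ j)
        = ?c j * (?F * G) ^ j * ?F ^ (?m - j)"
      by (simp add: coeff_map_poly power_mult_distrib mult_ac)
  qed
  then have "?F ^ ?m * eval_y h G - fps_of_poly (eliminate_y h f g)
      = (\<Sum>j\<le>?m. ((?F * G) ^ j - ?g ^ j) * (?c j * ?F ^ (?m - j)))"
    by (simp add: eliminate_y_def fps_of_poly_sum fps_of_poly_mult fps_of_poly_power
        sum_subtractf algebra_simps)
  moreover have "fps_X ^ N dvd (?F * G) ^ j - ?g ^ j" for j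
    using cong by (simp add: power_diff_sumr2)
  ultimately have "fps_X ^ N dvd ?F ^ ?m * eval_y h G - fps_of_poly (eliminate_y h f g)"
    by (simp add: dvd_sum)
  from dvd_diff[OF dvd_mult[OF h, of "?F ^ ?m"] this] show ?thesis by simp
qed

lemma degree_eliminate_y_le:
  assumes "\<And>i j. j \<le> degree h \<Longrightarrow> i + j \<le> total_degree h \<Longrightarrow>
    i + j * degree g + (degree h - j) * degree f \<le> B"
  shows "degree (eliminate_y h f g) \<le> B"
  unfolding eliminate_y_def
proof (rule degree_sum_le)
  fix j assume j: "j \<in> {..degree h}"
  show "degree (coeff h j * g ^ j * f ^ (degree h - j)) \<le> B"
  proof (cases "coeff h j = 0")
    case False
    have "degree (coeff h j * g ^ j * f ^ (degree h - j))
        \<le> degree (coeff h j) + degree (g ^ j) + degree (f ^ (degree h - j))"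
      by (intro order_trans[OF degree_mult_le] add_mono degree_mult_le order_refl)
    also have "\<dots> \<le> degree (coeff h j) + j * degree g + (degree h - j) * degree f"
      using degree_power_le[of g j] degree_power_le[of f "degree h - j"]
      by (intro add_mono) (simp_all add: mult.commute)
    also have "\<dots> \<le> B"
      using j degree_coeff_add_le_total_degree[OF False] by (intro assms) auto
    finally show ?thesis .
  qed simp
qed simp

text \<open>
  The rational root argument: in the vanishing sum, every term except the leading one contains a
  factor \<open>f\<close>, so \<open>f\<close> divides \<open>lead_coeff h * g ^ degree h\<close> and hence \<open>lead_coeff h\<close>. The
  strict inequality is due to the power of \<open>y\<close>, which is positive since \<open>h\<close> would otherwise be its
  own, nonzero, elimination result.
\<close>
lemma degree_less_total_degree_if_eliminate_y_0:
  assumes bez: "u * f + v * g = 1" and f: "f \<noteq> 0" and h: "h \<noteq> 0" and R: "eliminate_y h f g = 0"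
  shows "degree f < total_degree h"
proof -
  let ?m = "degree h"
  have "degree h \<noteq> 0"
  proof
    assume "degree h = 0"
    then have "eliminate_y h f g = lead_coeff h" by (simp add: eliminate_y_def)
    then show False using R h by simp
  qed
  have split: "{..?m} = insert ?m {..<?m}" by auto
  have "lead_coeff h * g ^ ?m = - (\<Sum>j<?m. coeff h j * g ^ j * f ^ (?m - j))"
    using R unfolding eliminate_y_def split by (simp add: eq_neg_iff_add_eq_0)
  also have "f dvd \<dots>"
    unfolding dvd_minus_iff by (intro dvd_sum dvd_mult) (auto intro: dvd_power)
  finally have "f dvd lead_coeff h" by (rule dvd_mult_power_cancel_bezout[OF bez])
  then have "degree f \<le> degree (lead_coeff h)" using h by (intro dvd_imp_degree_le) auto
  moreover have "degree (lead_coeff h) + ?m \<le> total_degree h"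
    using h by (intro degree_coeff_add_le_total_degree) simp
  ultimately show ?thesis using \<open>degree h \<noteq> 0\<close> by simp
qed

lemma le_degree_if_fps_X_power_dvd:
  fixes p :: "'a::comm_ring_1 poly"
  assumes "p \<noteq> 0" "fps_X ^ N dvd fps_of_poly p"
  shows "N \<le> degree p"
  using assms by (metis fps_X_power_dvd_iff fps_of_poly_nth leading_coeff_0_iff not_le)

section \<open>The bounds\<close>

theorem theorem3:
  fixes s c :: "nat \<Rightarrow> 'a::{field,finite}" and N L t :: nat
  assumes "N \<ge> 2"
    and "\<not> fps_X ^ N dvd Abs_fps s"
    and "L = linear_complexity s N"
    and "t \<le> L" and "c L = 1" and "c t \<noteq> 0"
    and "\<forall>i. i + L < N \<longrightarrow> (\<Sum>l=t..L. c l * s (i + l)) = 0"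
  shows "int (expansion_complexity s N) \<ge>
           (if int N > (int L - int t) * (int L - min 1 (int t - 1))
            then int L - int t + 1
            else \<lceil>real N / real_of_int (int L - min 1 (int t - 1))\<rceil>)
       \<and> int (expansion_complexity s N) \<le>
           min (int L + max (-1) (- int t + 1)) (int N - int L + 2)"
proof -
  define E where "E = expansion_complexity s N"
  define G where "G = Abs_fps s"
  have nz: "\<exists>i<N. s i \<noteq> 0" using assms(2) by (simp add: fps_X_power_dvd_iff)
  have "L > 0"
  proof (rule ccontr)
    assume "\<not> L > 0"
    then have "\<forall>i<N. s i = 0" using assms(4,5,7) by auto
    then show False using nz by blast
  qed
  have "L \<le> N"
    unfolding assms(3) by (rule linear_complexity_le[of 1]) auto

  define f where "f = truncate_fps (Suc (L - t)) (Abs_fps (\<lambda>k. c (L - k)))"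
  have coeff_f: "coeff f k = (if k \<le> L - t then c (L - k) else 0)" for k
    by (simp add: f_def coeff_truncate_fps)
  have f0: "coeff f 0 = 1" using assms(5) by (simp add: coeff_f)
  have deg_f: "degree f = L - t"
    using assms(4,6) by (intro antisym degree_le le_degree) (auto simp: coeff_f)
  have fG: "fps_nth (fps_of_poly f * G) k = 0" if "L \<le> k" "k < N" for k
  proof -
    define i where "i = k - L"
    have k: "k = i + L" using that by (simp add: i_def)
    have "fps_nth (fps_of_poly f * G) k = (\<Sum>l\<le>L. coeff f (L - l) * s (i + l))"
      unfolding k G_def by (subst fps_mult_nth_reversed) (auto simp: deg_f)
    also have "\<dots> = (\<Sum>l=t..L. coeff f (L - l) * s (i + l))"
      using assms(4) by (intro sum.mono_neutral_right) (auto simp: coeff_f)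
    also have "\<dots> = (\<Sum>l=t..L. c l * s (i + l))"
      by (intro sum.cong) (auto simp: coeff_f)
    finally show ?thesis using assms(7) that k by simp
  qed
  define g where "g = truncate_fps L (fps_of_poly f * G)"
  have coeff_g: "coeff g k = (if k < L then fps_nth (fps_of_poly f * G) k else 0)" for k
    by (simp add: g_def coeff_truncate_fps)
  have deg_g: "degree g \<le> L - 1" by (rule degree_le) (auto simp: coeff_g)
  have cong: "fps_X ^ N dvd fps_of_poly f * G - fps_of_poly g"
    using fG by (auto simp: fps_X_power_dvd_iff coeff_g)

  have upper1: "int E \<le> int L + max (-1) (- int t + 1)"
  proof -
    have "E \<le> max (L - t + 1) (L - 1)"
      unfolding E_def
    proof (rule expansion_complexity_le_linear)
      show "f \<noteq> 0" using f0 by auto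
      show "fps_nth (fps_of_poly f * Abs_fps s) k = 0"
        if "max (L - t + 1) (L - 1) < k" "k < N" for k
        using fG[of k] that by (auto simp: G_def)
    qed (simp add: deg_f)
    then show ?thesis using assms(4) \<open>L > 0\<close> by linarith
  qed

  \<comment> \<open>The factor \<open>x\<close> in \<open>pCons 0 a\<close> moves the coefficient of \<open>a G\<close> at \<open>N - 1\<close>, which need not
    vanish, to \<open>N\<close>.\<close>
  have upper2: "int E \<le> int N - int L + 2"
  proof -
    have "L - 1 < linear_complexity s N" "L - 1 < N"
      using assms(3) \<open>L > 0\<close> \<open>L \<le> N\<close> by auto
    then obtain a where a: "a \<noteq> 0" "degree a < N - (L - 1)"
      and aG: "\<And>k. N - (L - 1) \<le> Suc k \<Longrightarrow> Suc k < N \<Longrightarrow>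
        fps_nth (fps_of_poly a * Abs_fps s) k = 0"
      using annihilator_if_linear_complexity_gt by blast
    have "E \<le> N - L + 2"
      unfolding E_def
    proof (rule expansion_complexity_le_linear)
      show "pCons 0 a \<noteq> 0" using a by simp
      show "degree (pCons 0 a) < N - L + 2" using a \<open>L > 0\<close> \<open>L \<le> N\<close> by simp
      show "fps_nth (fps_of_poly (pCons 0 a) * Abs_fps s) k = 0" if "N - L + 2 < k" "k < N" for k
        using aG[of "k - 1"] that \<open>L > 0\<close> \<open>L \<le> N\<close>
        by (simp add: fps_of_poly_pCons mult.assoc mult.left_commute)
    qed
    then show ?thesis using \<open>L \<le> N\<close> by simp
  qed

  obtain h where h: "h \<noteq> 0" "fps_X ^ N dvd eval_y h G" "total_degree h = E"
    using expansion_complexity_attained[OF nz] by (auto simp: E_def G_def)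
  have "coeff f 0 \<noteq> 0" "degree f \<le> linear_complexity s N" "degree g < linear_complexity s N"
    using f0 deg_f deg_g \<open>L > 0\<close> assms(3) by auto
  then obtain u v where bez: "u * f + v * g = 1"
    using minimal_pair_bezout cong \<open>L > 0\<close> unfolding G_def assms(3) by blast
  \<comment> \<open>As the minimum is taken over the integers, \<open>M\<close> is \<open>L + 1\<close>, \<open>L\<close> or \<open>L - 1\<close> according to
    whether \<open>t\<close> is \<open>0\<close>, \<open>1\<close> or larger.\<close>
  define M where "M = nat (int L - min 1 (int t - 1))"
  have M: "int M = int L - min 1 (int t - 1)" "M > 0"
    using \<open>L > 0\<close> assms(4) by (auto simp: M_def)
  have dichotomy: "L - t < E \<or> N \<le> E * M"
  proof (cases "eliminate_y h f g = 0")
    case True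
    moreover have "f \<noteq> 0" using f0 by auto
    ultimately show ?thesis
      using degree_less_total_degree_if_eliminate_y_0[OF bez _ h(1)] h(3) deg_f by auto
  next
    case False
    have "N \<le> degree (eliminate_y h f g)"
      by (intro le_degree_if_fps_X_power_dvd False fps_X_power_dvd_eliminate_y[OF cong h(2)])
    also have "\<dots> \<le> E * M"
    proof (rule degree_eliminate_y_le)
      fix i j assume j: "j \<le> degree h" and ij: "i + j \<le> total_degree h"
      have "degree (lead_coeff h) + degree h \<le> total_degree h"
        using h(1) by (intro degree_coeff_add_le_total_degree) simp
      then have hE: "degree h \<le> E" using h(3) by simp
      have "i + j * degree g + (degree h - j) * degree f
          \<le> i + j * (L - 1) + (E - j) * (L - t)"
        using deg_g deg_f hE by (intro add_mono mult_mono) auto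
      \<comment> \<open>The exponent of \<open>x\<close> is at most \<open>E - j\<close>, so it adds at most one to the degree of each
        of the \<open>E - j\<close> factors \<open>f\<close>; and \<open>M\<close> bounds both \<open>L - t + 1\<close> and \<open>L - 1\<close>.\<close>
      also have "\<dots> \<le> (E - j) * Suc (L - t) + j * (L - 1)"
        using ij h(3) by simp
      also have "\<dots> \<le> (E - j) * M + j * M"
        using M assms(4) by (intro add_mono mult_le_mono2) linarith+
      also have "\<dots> = E * M"
        using j hE by (simp flip: add_mult_distrib)
      finally show "i + j * degree g + (degree h - j) * degree f \<le> E * M" .
    qed
    finally show ?thesis by simp
  qed

  have lower: "(if int N > (int L - int t) * int M then int L - int t + 1
      else \<lceil>real N / real_of_int (int M)\<rceil>) \<le> int E"
  proof (cases "L - t < E")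
    case True
    have "\<lceil>real N / real_of_int (int M)\<rceil> \<le> int E" if "\<not> int N > (int L - int t) * int M"
    proof -
      have "int N \<le> (int L - int t) * int M" using that by simp
      also have "\<dots> \<le> int E * int M" using True assms(4) by (intro mult_right_mono) auto
      finally have "N \<le> E * M" by (simp flip: of_nat_mult)
      then have "real N \<le> real E * real M" by (simp flip: of_nat_mult)
      then show ?thesis using M(2) by (simp add: ceiling_le_iff divide_le_eq)
    qed
    then show ?thesis using True assms(4) by auto
  next
    case False
    then have N: "N \<le> E * M" using dichotomy by simp
    have "int N \<le> int E * int M" using N by (simp flip: of_nat_mult)
    also have "\<dots> \<le> (int L - int t) * int M"
      using False assms(4) by (intro mult_right_mono) auto
    finally have "\<not> int N > (int L - int t) * int M" by simp
    moreover have "real N \<le> real E * real M" using N by (simp flip: of_nat_mult)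
    then have "\<lceil>real N / real_of_int (int M)\<rceil> \<le> int E"
      using M(2) by (simp add: ceiling_le_iff divide_le_eq)
    ultimately show ?thesis by simp
  qed
  show ?thesis
    using lower upper1 upper2 unfolding M(1) E_def by simp
qed

end
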